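(* The $\varphi$-sectional curvature of any semi-symmetric $(2n+s)$-dimensional generalized Kenmotsu manifold $(M,\varphi,\xi_i,\eta^i,g)$ is equal to $-s$.
   Context: Here $n,s\ge 1$. A metric $f$-manifold is a $(2n+s)$-dimensional smooth manifold $M$ with a $(1,1)$-tensor field $\varphi$, vector fields $\xi_1,\dots,\xi_s$, $1$-forms $\eta^1,\dots,\eta^s$ and a Riemannian metric $g$ such that $\varphi^2=-I+\sum_{i=1}^s\eta^i\otimes\xi_i$, $\eta^i(\xi_j)=\delta_{ij}$ and $g(\varphi X,\varphi Y)=g(X,Y)-\sum_{i=1}^s\eta^i(X)\eta^i(Y)$. The fundamental $2$-form is $\Phi(X,Y)=g(X,\varphi Y)$. A metric $f$-manifold is an almost $s$-contact metric manifold if $\eta^1\wedge\dots\wedge\eta^s\wedge\Phi^n\neq 0$ everywhere on $M$. It is normal if $[\varphi,\varphi]+2\sum_{i=1}^s d\eta^i\otimes\xi_i=0$, where $[\varphi,\varphi](X,Y)=\varphi^2[X,Y]+[\varphi X,\varphi Y]-\varphi[\varphi X,Y]-\varphi[X,\varphi Y]$ and $2d\eta(X,Y)=X\eta(Y)-Y\eta(X)-\eta([X,Y])$. An almost $s$-contact metric manifold is a generalized almost Kenmotsu manifold if all the $1$-forms $\eta^i$ are closed and $d\Phi=2\sum_{i=1}^s\eta^i\wedge\Phi$; a normal generalized almost Kenmotsu manifold is called a generalized Kenmotsu manifold. $\nabla$ is the Levi-Civita connection of $g$ and $R(X,Y)Z=\nabla_X\nabla_YZ-\nabla_Y\nabla_XZ-\nabla_{[X,Y]}Z$.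 $M$ is semi-symmetric if $R\cdot R=0$, where $R(X,Y)$ acts as a derivation on the tensor field $R$. Let $\mathcal{L}$ be the distribution orthogonal to $\xi_1,\dots,\xi_s$. The $\varphi$-sectional curvature is the sectional curvature of planes spanned by $X,\varphi X$ with $X\in\mathcal{L}$ a unit vector, i.e. $g(R(X,\varphi X)\varphi X,X)$. *)

theory Defs
  imports
    "HOL-Analysis.Analysis"
    "HOL-Combinatorics.Permutations"
    "HOL-Library.Function_Algebras"
begin

section \<open>Smooth manifolds\<close>

text \<open>
  The manifold is the whole of a Hausdorff, second countable type \<open>'a\<close>; it is modelled on the
  Euclidean space \<open>'e\<close> by an atlas of charts \<open>(U, \<psi>)\<close>. The atlas need not be maximal.
\<close>

text \<open>Only meant for open \<open>S\<close>.\<close>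

primrec Ck_on :: "nat \<Rightarrow> ('e::real_normed_vector \<Rightarrow> 'b::real_normed_vector) \<Rightarrow> 'e set \<Rightarrow> bool" where
  "Ck_on 0 f S \<longleftrightarrow> continuous_on S f"
| "Ck_on (Suc k) f S \<longleftrightarrow> (\<forall>x\<in>S. f differentiable (at x)) \<and>
     (\<forall>v. Ck_on k (\<lambda>x. frechet_derivative f (at x) v) S)"

definition smooth_on :: "('e::real_normed_vector \<Rightarrow> 'b::real_normed_vector) \<Rightarrow> 'e set \<Rightarrow> bool" where
  "smooth_on f S \<longleftrightarrow> (\<forall>k. Ck_on k f S)"

type_synonym ('a, 'e) atlas = "('a set \<times> ('a \<Rightarrow> 'e)) set"

definition smooth_atlas ::
  "('a::{t2_space,second_countable_topology}, 'e::euclidean_space) atlas \<Rightarrow> bool" where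
  "smooth_atlas A \<longleftrightarrow>
     (\<forall>(U, \<psi>)\<in>A. open U \<and> open (\<psi> ` U) \<and> homeomorphism U (\<psi> ` U) \<psi> (inv_into U \<psi>)) \<and>
     (\<Union>(U, \<psi>)\<in>A. U) = UNIV \<and>
     (\<forall>(U, \<psi>)\<in>A. \<forall>(V, \<psi>')\<in>A. smooth_on (\<psi>' \<circ> inv_into U \<psi>) (\<psi> ` (U \<inter> V)))"

definition smooth_functions :: "('a, 'e::euclidean_space) atlas \<Rightarrow> ('a \<Rightarrow> real) set" where
  "smooth_functions A = {f. \<forall>(U, \<psi>)\<in>A. smooth_on (f \<circ> inv_into U \<psi>) (\<psi> ` U)}"

text \<open>
  Tangent vectors at \<open>p\<close> are the derivations at \<open>p\<close> of the algebra of smooth functions. They are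
  made \<open>0\<close> on functions that are not smooth, so that equality of derivations is equality in HOL.
  Sums and differences of tangent vectors and of vector fields are the pointwise ones.
\<close>

type_synonym 'a tangent = "('a \<Rightarrow> real) \<Rightarrow> real"
type_synonym 'a vfield = "'a \<Rightarrow> 'a tangent"

definition scale :: "real \<Rightarrow> 'a tangent \<Rightarrow> 'a tangent"  (infixr \<open>*\<^sub>T\<close> 75) where
  "c *\<^sub>T v = (\<lambda>f. c * v f)"

definition tangent_space :: "('a, 'e::euclidean_space) atlas \<Rightarrow> 'a \<Rightarrow> 'a tangent set" where
  "tangent_space A p = {v.
     (\<forall>f\<in>smooth_functions A. \<forall>h\<in>smooth_functions A.
        v (\<lambda>q. f q + h q) = v f + v h \<and>
        v (\<lambda>q. f q * h q) = f p * v h + h p * v f) \<and>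
     (\<forall>c. \<forall>f\<in>smooth_functions A. v (\<lambda>q. c * f q) = c * v f) \<and>
     (\<forall>f. f \<notin> smooth_functions A \<longrightarrow> v f = 0)}"

definition lie_deriv :: "'a vfield \<Rightarrow> ('a \<Rightarrow> real) \<Rightarrow> 'a \<Rightarrow> real" where
  "lie_deriv X f = (\<lambda>p. X p f)"

definition vector_fields :: "('a, 'e::euclidean_space) atlas \<Rightarrow> 'a vfield set" where
  "vector_fields A = {X. (\<forall>p. X p \<in> tangent_space A p) \<and>
     (\<forall>f\<in>smooth_functions A. lie_deriv X f \<in> smooth_functions A)}"

definition fun_scale :: "('a \<Rightarrow> real) \<Rightarrow> 'a vfield \<Rightarrow> 'a vfield"  (infixr \<open>*\<^sub>F\<close> 75) where
  "f *\<^sub>F X = (\<lambda>p. f p *\<^sub>T X p)"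

definition bracket :: "'a vfield \<Rightarrow> 'a vfield \<Rightarrow> 'a vfield" where
  "bracket X Y = (\<lambda>p f. X p (lie_deriv Y f) - Y p (lie_deriv X f))"


section \<open>Tensor fields\<close>

text \<open>
  Tensor fields are families of multilinear maps on the tangent spaces (with irrelevant values
  outside them) that produce smooth objects from smooth vector fields.
\<close>

type_synonym 'a form1 = "'a \<Rightarrow> 'a tangent \<Rightarrow> real"
type_synonym 'a form2 = "'a \<Rightarrow> 'a tangent \<Rightarrow> 'a tangent \<Rightarrow> real"
type_synonym 'a endo = "'a \<Rightarrow> 'a tangent \<Rightarrow> 'a tangent"

definition app1 :: "('a \<Rightarrow> 'a tangent \<Rightarrow> 'b) \<Rightarrow> 'a vfield \<Rightarrow> 'a \<Rightarrow> 'b" where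
  "app1 T X = (\<lambda>p. T p (X p))"

definition app2 :: "('a \<Rightarrow> 'a tangent \<Rightarrow> 'a tangent \<Rightarrow> 'b) \<Rightarrow> 'a vfield \<Rightarrow> 'a vfield \<Rightarrow> 'a \<Rightarrow> 'b" where
  "app2 T X Y = (\<lambda>p. T p (X p) (Y p))"

definition one_form :: "('a, 'e::euclidean_space) atlas \<Rightarrow> 'a form1 \<Rightarrow> bool" where
  "one_form A \<eta> \<longleftrightarrow>
     (\<forall>p. \<forall>u\<in>tangent_space A p. \<forall>v\<in>tangent_space A p. \<eta> p (u + v) = \<eta> p u + \<eta> p v) \<and>
     (\<forall>p c. \<forall>v\<in>tangent_space A p. \<eta> p (c *\<^sub>T v) = c * \<eta> p v) \<and>
     (\<forall>X\<in>vector_fields A. app1 \<eta> X \<in> smooth_functions A)"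

definition endomorphism_field :: "('a, 'e::euclidean_space) atlas \<Rightarrow> 'a endo \<Rightarrow> bool" where
  "endomorphism_field A \<phi> \<longleftrightarrow>
     (\<forall>p. \<forall>v\<in>tangent_space A p. \<phi> p v \<in> tangent_space A p) \<and>
     (\<forall>p. \<forall>u\<in>tangent_space A p. \<forall>v\<in>tangent_space A p. \<phi> p (u + v) = \<phi> p u + \<phi> p v) \<and>
     (\<forall>p c. \<forall>v\<in>tangent_space A p. \<phi> p (c *\<^sub>T v) = c *\<^sub>T \<phi> p v) \<and>
     (\<forall>X\<in>vector_fields A. app1 \<phi> X \<in> vector_fields A)"

definition riemannian_metric :: "('a, 'e::euclidean_space) atlas \<Rightarrow> 'a form2 \<Rightarrow> bool" where
  "riemannian_metric A g \<longleftrightarrow>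
     (\<forall>p. \<forall>u\<in>tangent_space A p. \<forall>v\<in>tangent_space A p. \<forall>w\<in>tangent_space A p.
        g p (u + v) w = g p u w + g p v w) \<and>
     (\<forall>p c. \<forall>u\<in>tangent_space A p. \<forall>v\<in>tangent_space A p. g p (c *\<^sub>T u) v = c * g p u v) \<and>
     (\<forall>p. \<forall>u\<in>tangent_space A p. \<forall>v\<in>tangent_space A p. g p u v = g p v u) \<and>
     (\<forall>p. \<forall>v\<in>tangent_space A p. v \<noteq> 0 \<longrightarrow> 0 < g p v v) \<and>
     (\<forall>X\<in>vector_fields A. \<forall>Y\<in>vector_fields A. app2 g X Y \<in> smooth_functions A)"


section \<open>Exterior calculus\<close>

text \<open>
  An alternating \<open>k\<close>-form on a vector space is a function of a sequence of vectors of which only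
  the entries with index less than \<open>k\<close> matter. Wedge product and exterior derivative follow the
  convention with the factors \<open>1/(k+l)!\<close> and \<open>1/(k+1)\<close>, which is the one belonging to
  \<open>2 d\<eta>(X,Y) = X \<eta>(Y) - Y \<eta>(X) - \<eta>([X,Y])\<close>.
\<close>

type_synonym 'v alt_form = "(nat \<Rightarrow> 'v) \<Rightarrow> real"

definition wedge :: "nat \<Rightarrow> nat \<Rightarrow> 'v alt_form \<Rightarrow> 'v alt_form \<Rightarrow> 'v alt_form" where
  "wedge k l \<alpha> \<beta> = (\<lambda>v.
     (\<Sum>\<pi> | \<pi> permutes {..<k + l}.
        of_int (sign \<pi>) * \<alpha> (\<lambda>i. v (\<pi> i)) * \<beta> (\<lambda>i. v (\<pi> (k + i)))) / fact (k + l))"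

definition alt1 :: "('v \<Rightarrow> real) \<Rightarrow> 'v alt_form" where
  "alt1 \<alpha> = (\<lambda>v. \<alpha> (v 0))"

definition alt2 :: "('v \<Rightarrow> 'v \<Rightarrow> real) \<Rightarrow> 'v alt_form" where
  "alt2 \<beta> = (\<lambda>v. \<beta> (v 0) (v 1))"

primrec wedge_list :: "(nat \<Rightarrow> 'v \<Rightarrow> real) \<Rightarrow> nat \<Rightarrow> 'v alt_form" where
  "wedge_list \<alpha> 0 = (\<lambda>v. 1)"
| "wedge_list \<alpha> (Suc k) = wedge k 1 (wedge_list \<alpha> k) (alt1 (\<alpha> k))"

primrec wedge_power :: "('v \<Rightarrow> 'v \<Rightarrow> real) \<Rightarrow> nat \<Rightarrow> 'v alt_form" where
  "wedge_power \<beta> 0 = (\<lambda>v. 1)"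
| "wedge_power \<beta> (Suc k) = wedge (2 * k) 2 (wedge_power \<beta> k) (alt2 \<beta>)"

definition d1 :: "'a form1 \<Rightarrow> 'a vfield \<Rightarrow> 'a vfield \<Rightarrow> 'a \<Rightarrow> real" where
  "d1 \<eta> X Y = (\<lambda>p.
     (X p (app1 \<eta> Y) - Y p (app1 \<eta> X) - \<eta> p (bracket X Y p)) / 2)"

definition d2 :: "'a form2 \<Rightarrow> 'a vfield \<Rightarrow> 'a vfield \<Rightarrow> 'a vfield \<Rightarrow> 'a \<Rightarrow> real" where
  "d2 \<beta> X Y Z = (\<lambda>p.
     (X p (app2 \<beta> Y Z) + Y p (app2 \<beta> Z X) + Z p (app2 \<beta> X Y)
      - \<beta> p (bracket X Y p) (Z p) - \<beta> p (bracket Y Z p) (X p) - \<beta> p (bracket Z X p) (Y p)) / 3)"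


section \<open>Generalized Kenmotsu manifolds\<close>

text \<open>
  The index \<open>i\<close> of \<open>\<xi>\<close> and \<open>\<eta>\<close> runs over \<open>0, \<dots>, s - 1\<close>.
\<close>

definition metric_f_manifold ::
  "('a::{t2_space,second_countable_topology}, 'e::euclidean_space) atlas \<Rightarrow> nat \<Rightarrow> nat \<Rightarrow> 'a endo \<Rightarrow>
   (nat \<Rightarrow> 'a vfield) \<Rightarrow> (nat \<Rightarrow> 'a form1) \<Rightarrow> 'a form2 \<Rightarrow> bool" where
  "metric_f_manifold A n s \<phi> \<xi> \<eta> g \<longleftrightarrow>
     smooth_atlas A \<and> DIM('e) = 2 * n + s \<and>
     endomorphism_field A \<phi> \<and>
     (\<forall>i<s. \<xi> i \<in> vector_fields A) \<and>
     (\<forall>i<s. one_form A (\<eta> i)) \<and>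
     riemannian_metric A g \<and>
     (\<forall>p. \<forall>v\<in>tangent_space A p. \<phi> p (\<phi> p v) = - v + (\<Sum>i<s. \<eta> i p v *\<^sub>T \<xi> i p)) \<and>
     (\<forall>p. \<forall>i<s. \<forall>j<s. \<eta> i p (\<xi> j p) = (if i = j then 1 else 0)) \<and>
     (\<forall>p. \<forall>u\<in>tangent_space A p. \<forall>v\<in>tangent_space A p.
        g p (\<phi> p u) (\<phi> p v) = g p u v - (\<Sum>i<s. \<eta> i p u * \<eta> i p v))"

definition fundamental_form :: "'a endo \<Rightarrow> 'a form2 \<Rightarrow> 'a form2" where
  "fundamental_form \<phi> g = (\<lambda>p u v. g p u (\<phi> p v))"

definition almost_s_contact_metric_manifold ::
  "('a::{t2_space,second_countable_topology}, 'e::euclidean_space) atlas \<Rightarrow> nat \<Rightarrow> nat \<Rightarrow> 'a endo \<Rightarrow>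
   (nat \<Rightarrow> 'a vfield) \<Rightarrow> (nat \<Rightarrow> 'a form1) \<Rightarrow> 'a form2 \<Rightarrow> bool" where
  "almost_s_contact_metric_manifold A n s \<phi> \<xi> \<eta> g \<longleftrightarrow>
     metric_f_manifold A n s \<phi> \<xi> \<eta> g \<and>
     (\<forall>p. \<exists>v. (\<forall>i<2 * n + s. v i \<in> tangent_space A p) \<and>
        wedge s (2 * n) (wedge_list (\<lambda>i. \<eta> i p) s) (wedge_power (fundamental_form \<phi> g p) n) v \<noteq> 0)"

definition nijenhuis :: "'a endo \<Rightarrow> 'a vfield \<Rightarrow> 'a vfield \<Rightarrow> 'a vfield" where
  "nijenhuis \<phi> X Y =
     app1 \<phi> (app1 \<phi> (bracket X Y)) + bracket (app1 \<phi> X) (app1 \<phi> Y)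
     - app1 \<phi> (bracket (app1 \<phi> X) Y) - app1 \<phi> (bracket X (app1 \<phi> Y))"

definition normal_structure ::
  "('a, 'e::euclidean_space) atlas \<Rightarrow> nat \<Rightarrow> 'a endo \<Rightarrow> (nat \<Rightarrow> 'a vfield) \<Rightarrow> (nat \<Rightarrow> 'a form1) \<Rightarrow> bool"
  where
  "normal_structure A s \<phi> \<xi> \<eta> \<longleftrightarrow>
     (\<forall>X\<in>vector_fields A. \<forall>Y\<in>vector_fields A.
        nijenhuis \<phi> X Y + (\<Sum>i<s. (\<lambda>p. 2 * d1 (\<eta> i) X Y p) *\<^sub>F \<xi> i) = 0)"

definition generalized_almost_Kenmotsu_manifold ::
  "('a::{t2_space,second_countable_topology}, 'e::euclidean_space) atlas \<Rightarrow> nat \<Rightarrow> nat \<Rightarrow> 'a endo \<Rightarrow>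
   (nat \<Rightarrow> 'a vfield) \<Rightarrow> (nat \<Rightarrow> 'a form1) \<Rightarrow> 'a form2 \<Rightarrow> bool" where
  "generalized_almost_Kenmotsu_manifold A n s \<phi> \<xi> \<eta> g \<longleftrightarrow>
     almost_s_contact_metric_manifold A n s \<phi> \<xi> \<eta> g \<and>
     (\<forall>i<s. \<forall>X\<in>vector_fields A. \<forall>Y\<in>vector_fields A. \<forall>p. d1 (\<eta> i) X Y p = 0) \<and>
     (\<forall>X\<in>vector_fields A. \<forall>Y\<in>vector_fields A. \<forall>Z\<in>vector_fields A. \<forall>p.
        d2 (fundamental_form \<phi> g) X Y Z p =
        2 * (\<Sum>i<s. wedge 1 2 (alt1 (\<eta> i p)) (alt2 (fundamental_form \<phi> g p))
                     (\<lambda>j. [X p, Y p, Z p] ! j)))"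

definition generalized_Kenmotsu_manifold ::
  "('a::{t2_space,second_countable_topology}, 'e::euclidean_space) atlas \<Rightarrow> nat \<Rightarrow> nat \<Rightarrow> 'a endo \<Rightarrow>
   (nat \<Rightarrow> 'a vfield) \<Rightarrow> (nat \<Rightarrow> 'a form1) \<Rightarrow> 'a form2 \<Rightarrow> bool" where
  "generalized_Kenmotsu_manifold A n s \<phi> \<xi> \<eta> g \<longleftrightarrow>
     generalized_almost_Kenmotsu_manifold A n s \<phi> \<xi> \<eta> g \<and> normal_structure A s \<phi> \<xi> \<eta>"

definition horizontal_space ::
  "('a, 'e::euclidean_space) atlas \<Rightarrow> nat \<Rightarrow> (nat \<Rightarrow> 'a vfield) \<Rightarrow> 'a form2 \<Rightarrow> 'a \<Rightarrow> 'a tangent set" where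
  "horizontal_space A s \<xi> g p = {v \<in> tangent_space A p. \<forall>i<s. g p v (\<xi> i p) = 0}"


section \<open>Curvature\<close>

text \<open>
  A connection is a map \<open>D\<close> with \<open>D X Y\<close> for the derivative of \<open>Y\<close> in the direction \<open>X\<close>; its
  values are irrelevant if \<open>X\<close> or \<open>Y\<close> is not a smooth vector field.
\<close>

type_synonym 'a connection = "'a vfield \<Rightarrow> 'a vfield \<Rightarrow> 'a vfield"

definition affine_connection :: "('a, 'e::euclidean_space) atlas \<Rightarrow> 'a connection \<Rightarrow> bool" where
  "affine_connection A D \<longleftrightarrow>
     (\<forall>X\<in>vector_fields A. \<forall>Y\<in>vector_fields A. D X Y \<in> vector_fields A) \<and>
     (\<forall>X\<in>vector_fields A. \<forall>Y\<in>vector_fields A. \<forall>Z\<in>vector_fields A.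
        D (X + Y) Z = D X Z + D Y Z \<and> D X (Y + Z) = D X Y + D X Z) \<and>
     (\<forall>f\<in>smooth_functions A. \<forall>X\<in>vector_fields A. \<forall>Y\<in>vector_fields A.
        D (f *\<^sub>F X) Y = f *\<^sub>F D X Y \<and> D X (f *\<^sub>F Y) = lie_deriv X f *\<^sub>F Y + f *\<^sub>F D X Y)"

definition levi_civita_connection ::
  "('a, 'e::euclidean_space) atlas \<Rightarrow> 'a form2 \<Rightarrow> 'a connection \<Rightarrow> bool" where
  "levi_civita_connection A g D \<longleftrightarrow>
     affine_connection A D \<and>
     (\<forall>X\<in>vector_fields A. \<forall>Y\<in>vector_fields A. D X Y - D Y X = bracket X Y) \<and>
     (\<forall>X\<in>vector_fields A. \<forall>Y\<in>vector_fields A. \<forall>Z\<in>vector_fields A.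
        \<forall>p. X p (app2 g Y Z) = g p (D X Y p) (Z p) + g p (Y p) (D X Z p))"

definition curvature :: "'a connection \<Rightarrow> 'a vfield \<Rightarrow> 'a vfield \<Rightarrow> 'a vfield \<Rightarrow> 'a vfield" where
  "curvature D X Y Z = D X (D Y Z) - D Y (D X Z) - D (bracket X Y) Z"

definition semi_symmetric :: "('a, 'e::euclidean_space) atlas \<Rightarrow> 'a connection \<Rightarrow> bool" where
  "semi_symmetric A D \<longleftrightarrow>
     (\<forall>X\<in>vector_fields A. \<forall>Y\<in>vector_fields A.
      \<forall>U\<in>vector_fields A. \<forall>V\<in>vector_fields A. \<forall>W\<in>vector_fields A.
        curvature D X Y (curvature D U V W) - curvature D (curvature D X Y U) V W
        - curvature D U (curvature D X Y V) W - curvature D U V (curvature D X Y W) = 0)"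

text \<open>
  The \<open>\<phi>\<close>-sectional curvature at \<open>p\<close> of the plane spanned by \<open>X p\<close> and \<open>\<phi> p (X p)\<close>, for a smooth
  vector field \<open>X\<close> such that \<open>X p\<close> is a unit vector in the horizontal space at \<open>p\<close>. The curvature is
  an operation on vector fields, so a tangent vector enters through a vector field extending it;
  by tensoriality the choice of the extension is immaterial.
\<close>

definition phi_sectional_curvature ::
  "'a endo \<Rightarrow> 'a form2 \<Rightarrow> 'a connection \<Rightarrow> 'a vfield \<Rightarrow> 'a \<Rightarrow> real" where
  "phi_sectional_curvature \<phi> g D X p =
     g p (curvature D X (app1 \<phi> X) (app1 \<phi> X) p) (X p)"

end

theory Submission
  imports Defs
begin

text \<open>
  Write \<open>P\<close> for the orthogonal projection to the horizontal distribution and \<open>\<eta>\<close> for the sum of the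
  \<open>\<eta>\<^sup>i\<close>. Normality and \<open>d\<eta>\<^sup>i = 0\<close> give \<open>L\<^bsub>\<xi>\<^sub>i\<^esub> \<phi> = 0\<close>, and the equation for \<open>d\<Phi>\<close> gives
  \<open>L\<^bsub>\<xi>\<^sub>i\<^esub> \<Phi> = 2 \<Phi>\<close>, so that \<open>(L\<^bsub>\<xi>\<^sub>i\<^esub> g)(X, Y) = 2 g(P X, Y)\<close>; as \<open>\<eta>\<^sup>i\<close> is closed, this means
  \<open>\<nabla>\<^sub>X \<xi>\<^sub>i = P X\<close>. Hence \<open>R(X, Y) \<xi>\<^sub>i = \<eta>(X) P Y - \<eta>(Y) P X\<close>, and by pair symmetry \<open>R(\<xi>\<^sub>i, X) Z\<close> is known
  as well. For horizontal \<open>X, U, V\<close> the identity \<open>(R(\<xi>\<^sub>i, X) \<cdot> R)(U, V) \<xi>\<^sub>i = 0\<close> then reads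
  \<open>R(U, V) X = s (g(X, U) V - g(X, V) U)\<close>.
\<close>

section \<open>Smooth functions\<close>

text \<open>\<open>frechet_derivative\<close> at \<open>x\<close> depends on a neighbourhood of
  \<open>x\<close>. Since \<open>S\<close> is open, agreement on \<open>S\<close> is agreement near
  each of its points and so passes to the derivatives of every order.\<close>

lemma Ck_on_cong:
  assumes "open S" and "\<And>x. x \<in> S \<Longrightarrow> f x = h x" and "Ck_on k f S"
  shows "Ck_on k h S"
  using assms(2,3)
proof (induction k arbitrary: f h)
  case 0
  then show ?case
    by (simp add: continuous_on_cong[of S S f h])
next
  case (Suc k)
  have diff: "f differentiable (at x)" if "x \<in> S" for x
    using Suc.prems(2) that by simp
  have "h differentiable (at x)" if "x \<in> S" for x
  proof -
    have "(f has_derivative frechet_derivative f (at x)) (at x)"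
      using diff[OF that] frechet_derivative_works by blast
    then have "(h has_derivative frechet_derivative f (at x)) (at x)"
      using has_derivative_transform_within_open[OF _ assms(1) that] Suc.prems(1) by blast
    then show ?thesis
      using differentiable_def by blast
  qed
  moreover have "Ck_on k (\<lambda>x. frechet_derivative h (at x) v) S" for v
  proof (rule Suc.IH)
    show "frechet_derivative f (at x) v = frechet_derivative h (at x) v" if "x \<in> S" for x
      using frechet_derivative_transform_within_open[OF diff[OF that] assms(1) that] Suc.prems(1)
      by simp
    show "Ck_on k (\<lambda>x. frechet_derivative f (at x) v) S"
      using Suc.prems(2) by simp
  qed
  ultimately show ?case
    by simp
qed

lemma Ck_on_SucD: "Ck_on (Suc k) f S \<Longrightarrow> Ck_on k f S"
proof (induction k arbitrary: f)
  case 0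
  then show ?case
    by (auto intro!: continuous_at_imp_continuous_on differentiable_imp_continuous_within)
next
  case (Suc k)
  show ?case
    using Suc.prems Suc.IH[of "\<lambda>x. frechet_derivative f (at x) v" for v]
    unfolding Ck_on.simps(2)[of "Suc k" f] Ck_on.simps(2)[of k f] by blast
qed

lemma Ck_on_const: "Ck_on k (\<lambda>_. c) S"
  by (induction k arbitrary: c) auto

lemma Ck_on_add:
  assumes "open S" and "Ck_on k f S" and "Ck_on k h S"
  shows "Ck_on k (\<lambda>x. f x + h x) S"
  using assms(2,3)
proof (induction k arbitrary: f h)
  case 0
  then show ?case
    by (simp add: continuous_on_add)
next
  case (Suc k)
  have "Ck_on k (\<lambda>x. frechet_derivative (\<lambda>x. f x + h x) (at x) v) S" for v
  proof (rule Ck_on_cong[OF assms(1)])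
    show "Ck_on k (\<lambda>x. frechet_derivative f (at x) v + frechet_derivative h (at x) v) S"
      using Suc by simp
    show "frechet_derivative f (at x) v + frechet_derivative h (at x) v =
        frechet_derivative (\<lambda>x. f x + h x) (at x) v" if "x \<in> S" for x
    proof -
      have "((\<lambda>x. f x + h x) has_derivative
          (\<lambda>v. frechet_derivative f (at x) v + frechet_derivative h (at x) v)) (at x)"
        using that Suc.prems by (intro has_derivative_add) (auto simp: frechet_derivative_works)
      from frechet_derivative_at[OF this] show ?thesis
        by metis
    qed
  qed
  then show ?case
    using Suc.prems by simp
qed

lemma Ck_on_mult:
  fixes f h :: "'e::real_normed_vector \<Rightarrow> real"
  assumes "open S" and "Ck_on k f S" and "Ck_on k h S"
  shows "Ck_on k (\<lambda>x. f x * h x) S"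
  using assms(2,3)
proof (induction k arbitrary: f h)
  case 0
  then show ?case
    by (simp add: continuous_on_mult)
next
  case (Suc k)
  have "Ck_on k (\<lambda>x. frechet_derivative (\<lambda>x. f x * h x) (at x) v) S" for v
  proof (rule Ck_on_cong[OF assms(1)])
    \<comment> \<open>The product rule leaves undifferentiated factors of order
      \<open>Suc k\<close>; they are lowered to order \<open>k\<close> so that the induction
      hypothesis applies.\<close>
    show "Ck_on k (\<lambda>x. f x * frechet_derivative h (at x) v + frechet_derivative f (at x) v * h x) S"
      using Suc.prems by (intro Ck_on_add assms Suc.IH) (auto intro: Ck_on_SucD)
    show "f x * frechet_derivative h (at x) v + frechet_derivative f (at x) v * h x =
        frechet_derivative (\<lambda>x. f x * h x) (at x) v" if "x \<in> S" for x
    proof -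
      have "((\<lambda>x. f x * h x) has_derivative
          (\<lambda>v. f x * frechet_derivative h (at x) v + frechet_derivative f (at x) v * h x)) (at x)"
        using that Suc.prems by (intro has_derivative_mult) (auto simp: frechet_derivative_works)
      from frechet_derivative_at[OF this] show ?thesis
        by metis
    qed
  qed
  then show ?case
    using Suc.prems by simp
qed

section \<open>Pointwise sums, and the wedge product of a 1-form with a 2-form\<close>

lemma sum_fun_apply: "(\<Sum>i\<in>I. F i) x = (\<Sum>i\<in>I. F i x)"
  by (induction I rule: infinite_finite_induct) auto

text \<open>\<open>b\<close> is not assumed skew, so all six permutations contribute separately;
  skewness of the fundamental form is deduced later from this very expansion.\<close>

lemma wedge_1_2:
  "wedge 1 2 (alt1 a) (alt2 b) v =
    (a (v 0) * (b (v 1) (v 2) - b (v 2) (v 1)) + a (v 1) * (b (v 2) (v 0) - b (v 0) (v 2))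
      + a (v 2) * (b (v 0) (v 1) - b (v 1) (v 0))) / 6"
proof -
  define F where "F \<pi> = of_int (sign \<pi>) * a (v (\<pi> 0)) * b (v (\<pi> 1)) (v (\<pi> 2))" for \<pi>
  have "wedge 1 2 (alt1 a) (alt2 b) v = (\<Sum>\<pi> | \<pi> permutes {0, 1, 2}. F \<pi>) / 6"
  proof -
    have "{..<1 + 2} = {0, 1, 2::nat}" and "1 + 1 = (2 :: nat)"
      by auto
    then show ?thesis
      by (simp only: wedge_def alt1_def alt2_def F_def) (simp add: fact_numeral)
  qed
  \<comment> \<open>Each permutation factors uniquely into these two transpositions, the identity
    being allowed for either, which makes its sign computable.\<close>
  also have "(\<Sum>\<pi> | \<pi> permutes {0, 1, 2}. F \<pi>) =
      (\<Sum>i\<in>{0, 1, 2}. \<Sum>j\<in>{1, 2}. F (Transposition.transpose 0 i \<circ> Transposition.transpose 1 j))"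
    by (simp add: sum_over_permutations_insert del: One_nat_def)
  also have "\<dots> = a (v 0) * (b (v 1) (v 2) - b (v 2) (v 1)) + a (v 1) * (b (v 2) (v 0) - b (v 0) (v 2))
      + a (v 2) * (b (v 0) (v 1) - b (v 1) (v 0))"
    by (simp add: F_def sign_compose permutation_swap_id sign_swap_id Transposition.transpose_def algebra_simps
        del: One_nat_def)
  finally show ?thesis .
qed

locale smooth_manifold =
  fixes A :: "('a::{t2_space,second_countable_topology}, 'e::euclidean_space) atlas"
  assumes atlas: "smooth_atlas A"
begin

lemma open_chart: "(U, \<psi>) \<in> A \<Longrightarrow> open (\<psi> ` U)"
  using atlas by (auto simp: smooth_atlas_def)

lemma smooth_const: "(\<lambda>_. c) \<in> smooth_functions A"
  by (auto simp: smooth_functions_def smooth_on_def o_def Ck_on_const)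

lemma smooth_add:
  "f \<in> smooth_functions A \<Longrightarrow> h \<in> smooth_functions A \<Longrightarrow> (\<lambda>q. f q + h q) \<in> smooth_functions A"
  by (fastforce simp: smooth_functions_def smooth_on_def o_def intro!: Ck_on_add open_chart)

lemma smooth_mult:
  "f \<in> smooth_functions A \<Longrightarrow> h \<in> smooth_functions A \<Longrightarrow> (\<lambda>q. f q * h q) \<in> smooth_functions A"
  by (fastforce simp: smooth_functions_def smooth_on_def o_def intro!: Ck_on_mult open_chart)

lemma smooth_diff:
  "f \<in> smooth_functions A \<Longrightarrow> h \<in> smooth_functions A \<Longrightarrow> (\<lambda>q. f q - h q) \<in> smooth_functions A"
  using smooth_add[OF _ smooth_mult[OF smooth_const[of "-1"]], of f h] by simp

lemma smooth_uminus: "f \<in> smooth_functions A \<Longrightarrow> (\<lambda>q. - f q) \<in> smooth_functions A"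
  using smooth_diff[OF smooth_const, of f 0] by simp

section \<open>Vector fields\<close>

lemma tangent_apply_add:
  "v \<in> tangent_space A p \<Longrightarrow> f \<in> smooth_functions A \<Longrightarrow> h \<in> smooth_functions A \<Longrightarrow>
    v (\<lambda>q. f q + h q) = v f + v h"
  by (simp add: tangent_space_def)

lemma tangent_apply_mult:
  "v \<in> tangent_space A p \<Longrightarrow> f \<in> smooth_functions A \<Longrightarrow> h \<in> smooth_functions A \<Longrightarrow>
    v (\<lambda>q. f q * h q) = f p * v h + h p * v f"
  by (simp add: tangent_space_def)

lemma tangent_apply_cmult:
  "v \<in> tangent_space A p \<Longrightarrow> f \<in> smooth_functions A \<Longrightarrow> v (\<lambda>q. c * f q) = c * v f"
  by (simp add: tangent_space_def)

lemma tangent_apply_not_smooth: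
  "v \<in> tangent_space A p \<Longrightarrow> f \<notin> smooth_functions A \<Longrightarrow> v f = 0"
  by (simp add: tangent_space_def)

lemma tangent_apply_diff:
  "v \<in> tangent_space A p \<Longrightarrow> f \<in> smooth_functions A \<Longrightarrow> h \<in> smooth_functions A \<Longrightarrow>
    v (\<lambda>q. f q - h q) = v f - v h"
  using tangent_apply_add[of v p f "\<lambda>q. -1 * h q"] tangent_apply_cmult[of v p h "-1"]
    smooth_mult[OF smooth_const[of "-1"], of h] by simp

text \<open>The Leibniz rule for \<open>1 * 1\<close> gives \<open>v 1 = 2 * v 1\<close>, hence
  \<open>v 1 = 0\<close>; homogeneity extends this to all constants.\<close>

lemma tangent_apply_const: "v \<in> tangent_space A p \<Longrightarrow> v (\<lambda>_. c) = 0"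
  using tangent_apply_mult[OF _ smooth_const smooth_const, of v p 1 1]
    tangent_apply_cmult[OF _ smooth_const, of v p c 1] by simp

lemma tangent_add:
  "u \<in> tangent_space A p \<Longrightarrow> v \<in> tangent_space A p \<Longrightarrow> u + v \<in> tangent_space A p"
  by (simp add: tangent_space_def algebra_simps)

lemma tangent_scale: "v \<in> tangent_space A p \<Longrightarrow> c *\<^sub>T v \<in> tangent_space A p"
  by (simp add: tangent_space_def scale_def algebra_simps)

lemma vf_tangent: "X \<in> vector_fields A \<Longrightarrow> X p \<in> tangent_space A p"
  by (simp add: vector_fields_def)

lemma vf_smooth:
  "X \<in> vector_fields A \<Longrightarrow> f \<in> smooth_functions A \<Longrightarrow> (\<lambda>p. X p f) \<in> smooth_functions A"
  by (simp add: vector_fields_def lie_deriv_def)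

lemma vf_const: "X \<in> vector_fields A \<Longrightarrow> X p (\<lambda>_. c) = 0"
  using tangent_apply_const[OF vf_tangent] .

lemma vf_add: "X \<in> vector_fields A \<Longrightarrow> Y \<in> vector_fields A \<Longrightarrow> X + Y \<in> vector_fields A"
  by (auto simp: vector_fields_def lie_deriv_def tangent_add smooth_add)

lemma vf_fun_scale:
  "f \<in> smooth_functions A \<Longrightarrow> X \<in> vector_fields A \<Longrightarrow> f *\<^sub>F X \<in> vector_fields A"
  by (auto simp: vector_fields_def lie_deriv_def fun_scale_def tangent_scale)
    (auto simp: scale_def smooth_mult)

lemma uminus_vf: "- X = (\<lambda>_. - 1) *\<^sub>F (X :: 'a vfield)"
  by (auto simp: fun_scale_def scale_def fun_eq_iff)

lemma vf_uminus: "X \<in> vector_fields A \<Longrightarrow> - X \<in> vector_fields A"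
  by (simp add: uminus_vf vf_fun_scale smooth_const)

lemma vf_diff: "X \<in> vector_fields A \<Longrightarrow> Y \<in> vector_fields A \<Longrightarrow> X - Y \<in> vector_fields A"
  using vf_add[OF _ vf_uminus] by fastforce

lemma vf_zero: "0 \<in> vector_fields A"
  by (auto simp: vector_fields_def lie_deriv_def tangent_space_def smooth_const)

lemma vf_sum: "\<forall>i\<in>I. F i \<in> vector_fields A \<Longrightarrow> sum F I \<in> vector_fields A"
  by (induction I rule: infinite_finite_induct) (auto simp: vf_zero vf_add)

text \<open>In the Leibniz rule the cross terms \<open>X(f) Y(h) + X(h) Y(f)\<close> are symmetric
  in \<open>X\<close> and \<open>Y\<close> and cancel in the commutator. On a non-smooth function
  both inner derivatives are the zero function, which tangent vectors kill.\<close>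

lemma vf_bracket:
  assumes X: "X \<in> vector_fields A" and Y: "Y \<in> vector_fields A"
  shows "bracket X Y \<in> vector_fields A"
proof -
  note XY = vf_tangent[OF X] vf_tangent[OF Y] vf_smooth[OF X] vf_smooth[OF Y]
  have "bracket X Y p \<in> tangent_space A p" for p
    unfolding tangent_space_def bracket_def lie_deriv_def
    by (auto simp: XY tangent_apply_add[of _ p] tangent_apply_mult[of _ p] tangent_apply_cmult[of _ p]
        smooth_add smooth_mult
        tangent_apply_not_smooth[OF vf_tangent[OF X]] tangent_apply_not_smooth[OF vf_tangent[OF Y]]
        tangent_apply_add[OF vf_tangent[OF X]] tangent_apply_add[OF vf_tangent[OF Y]]
        tangent_apply_mult[OF vf_tangent[OF X]] tangent_apply_mult[OF vf_tangent[OF Y]]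
        tangent_apply_cmult[OF vf_tangent[OF X]] tangent_apply_cmult[OF vf_tangent[OF Y]]
        tangent_apply_const[OF vf_tangent[OF X]] tangent_apply_const[OF vf_tangent[OF Y]]
        algebra_simps)
  moreover have "lie_deriv (bracket X Y) f \<in> smooth_functions A" if "f \<in> smooth_functions A" for f
    using that by (auto simp: bracket_def lie_deriv_def XY intro!: smooth_diff)
  ultimately show ?thesis
    by (simp add: vector_fields_def)
qed

lemma bracket_swap: "bracket Y X = - bracket X (Y :: 'a vfield)"
  by (auto simp: bracket_def fun_eq_iff)

lemma bracket_apply: "bracket X Y p f = X p (\<lambda>q. Y q f) - Y p (\<lambda>q. X q f)"
  by (simp add: bracket_def lie_deriv_def)

lemma jacobi:
  assumes X: "X \<in> vector_fields A" and Y: "Y \<in> vector_fields A" and Z: "Z \<in> vector_fields A"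
  shows "bracket X (bracket Y Z) + bracket Y (bracket Z X) + bracket Z (bracket X Y) = 0"
proof -
  note XYZ = vf_tangent[OF X] vf_tangent[OF Y] vf_tangent[OF Z]
  have "(bracket X (bracket Y Z) + bracket Y (bracket Z X) + bracket Z (bracket X Y)) p f = 0"
    if f: "f \<in> smooth_functions A" for p f
    by (simp add: bracket_apply tangent_apply_diff[OF XYZ(1)] tangent_apply_diff[OF XYZ(2)]
        tangent_apply_diff[OF XYZ(3)] vf_smooth[OF X] vf_smooth[OF Y] vf_smooth[OF Z] f)
  \<comment> \<open>Equality of fields in HOL also concerns non-smooth functions, on which tangent
    vectors vanish by convention.\<close>
  moreover have "(bracket X (bracket Y Z) + bracket Y (bracket Z X) + bracket Z (bracket X Y)) p f = 0"
    if f: "f \<notin> smooth_functions A" for p f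
    by (simp add: tangent_apply_not_smooth[OF vf_tangent f, of "bracket _ _"] vf_bracket X Y Z)
  ultimately show ?thesis
    by (auto simp: fun_eq_iff)
qed

lemma bracket_fun_scale_left:
  assumes f: "f \<in> smooth_functions A" and X: "X \<in> vector_fields A" and Y: "Y \<in> vector_fields A"
  shows "bracket (f *\<^sub>F X) Y p = f p *\<^sub>T bracket X Y p + (- Y p f) *\<^sub>T X p"
proof
  fix h
  show "bracket (f *\<^sub>F X) Y p h = (f p *\<^sub>T bracket X Y p + (- Y p f) *\<^sub>T X p) h"
  proof (cases "h \<in> smooth_functions A")
    case True
    then show ?thesis
      by (simp add: bracket_apply fun_scale_def scale_def tangent_apply_mult[OF vf_tangent[OF Y]]
          f vf_smooth[OF X] algebra_simps)
  next
    case False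
    with f X Y show ?thesis
      by (simp add: scale_def tangent_apply_not_smooth[OF vf_tangent False] vf_bracket vf_fun_scale)
  qed
qed

lemma bracket_fun_scale_right:
  assumes f: "f \<in> smooth_functions A" and X: "X \<in> vector_fields A" and Y: "Y \<in> vector_fields A"
  shows "bracket Y (f *\<^sub>F X) p = f p *\<^sub>T bracket Y X p + Y p f *\<^sub>T X p"
  using bracket_fun_scale_left[OF f X Y, of p]
  by (simp add: bracket_swap[of Y "f *\<^sub>F X"] bracket_swap[of Y X] fun_eq_iff scale_def)

declare smooth_const [simp] smooth_add [simp] smooth_mult [simp] smooth_diff [simp] smooth_uminus [simp]
  vf_tangent [simp] vf_add [simp] vf_fun_scale [simp] vf_uminus [simp] vf_diff [simp]
  vf_zero [simp] vf_sum [simp] vf_bracket [simp]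

end

section \<open>The Levi-Civita connection and its curvature\<close>

locale riemannian_manifold = smooth_manifold A
  for A :: "('a::{t2_space,second_countable_topology}, 'e::euclidean_space) atlas" +
  fixes g :: "'a form2" and D :: "'a connection"
  assumes metric: "riemannian_metric A g"
    and levi_civita: "levi_civita_connection A g D"
begin

abbreviation G :: "'a vfield \<Rightarrow> 'a vfield \<Rightarrow> 'a \<Rightarrow> real" where
  "G \<equiv> app2 g"

abbreviation R :: "'a vfield \<Rightarrow> 'a vfield \<Rightarrow> 'a vfield \<Rightarrow> 'a vfield" where
  "R \<equiv> curvature D"

lemma G_smooth [simp]:
  "X \<in> vector_fields A \<Longrightarrow> Y \<in> vector_fields A \<Longrightarrow> G X Y \<in> smooth_functions A"
  using metric by (simp add: riemannian_metric_def)

lemma G_sym: "X \<in> vector_fields A \<Longrightarrow> Y \<in> vector_fields A \<Longrightarrow> G X Y p = G Y X p"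
  using metric by (simp add: riemannian_metric_def app2_def)

lemma G_add_left [simp]:
  "X \<in> vector_fields A \<Longrightarrow> Y \<in> vector_fields A \<Longrightarrow> Z \<in> vector_fields A \<Longrightarrow>
    G (X + Y) Z p = G X Z p + G Y Z p"
  using metric by (simp add: riemannian_metric_def app2_def)

lemma G_fun_scale_left [simp]:
  "X \<in> vector_fields A \<Longrightarrow> Z \<in> vector_fields A \<Longrightarrow> G (f *\<^sub>F X) Z p = f p * G X Z p"
  using metric by (simp add: riemannian_metric_def app2_def fun_scale_def)

lemma G_add_right [simp]:
  "X \<in> vector_fields A \<Longrightarrow> Y \<in> vector_fields A \<Longrightarrow> Z \<in> vector_fields A \<Longrightarrow>
    G Z (X + Y) p = G Z X p + G Z Y p"
  using G_sym[of Z X p] G_sym[of Z Y p] G_sym[of Z "X + Y" p] by simp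

lemma G_fun_scale_right [simp]:
  "X \<in> vector_fields A \<Longrightarrow> Z \<in> vector_fields A \<Longrightarrow> f \<in> smooth_functions A \<Longrightarrow>
    G Z (f *\<^sub>F X) p = f p * G Z X p"
  using G_sym[of Z X p] G_sym[of Z "f *\<^sub>F X" p] by simp

lemma G_uminus [simp]:
  assumes "X \<in> vector_fields A" and "Z \<in> vector_fields A"
  shows "G (- X) Z p = - G X Z p" and "G Z (- X) p = - G Z X p"
  using assms by (simp_all add: uminus_vf)

lemma G_diff [simp]:
  assumes "X \<in> vector_fields A" and "Y \<in> vector_fields A" and "Z \<in> vector_fields A"
  shows "G (X - Y) Z p = G X Z p - G Y Z p" and "G Z (X - Y) p = G Z X p - G Z Y p"
  using assms G_add_left[of X "- Y" Z p] G_add_right[of X "- Y" Z p] by simp_all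

lemma G_zero [simp]:
  assumes "Z \<in> vector_fields A"
  shows "G 0 Z p = 0" and "G Z 0 p = 0"
  using assms G_diff[of 0 0 Z p] by simp_all

lemma G_sum_left [simp]:
  "\<forall>i\<in>I. F i \<in> vector_fields A \<Longrightarrow> Z \<in> vector_fields A \<Longrightarrow>
    G (\<Sum>i\<in>I. F i) Z p = (\<Sum>i\<in>I. G (F i) Z p)"
  by (induction I rule: infinite_finite_induct) auto

lemma G_sum_right [simp]:
  "\<forall>i\<in>I. F i \<in> vector_fields A \<Longrightarrow> Z \<in> vector_fields A \<Longrightarrow>
    G Z (\<Sum>i\<in>I. F i) p = (\<Sum>i\<in>I. G Z (F i) p)"
  by (induction I rule: infinite_finite_induct) auto

lemma vf_eq_zeroI:
  assumes "X \<in> vector_fields A" and "\<And>p. G X X p = 0"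
  shows "X = 0"
proof
  fix p
  have "\<forall>v\<in>tangent_space A p. v \<noteq> 0 \<longrightarrow> 0 < g p v v"
    using metric by (simp add: riemannian_metric_def)
  then show "X p = 0 p"
    using assms(2)[of p] vf_tangent[OF assms(1), of p] by (fastforce simp: app2_def)
qed

lemma vf_eqI:
  assumes "X \<in> vector_fields A" and "Y \<in> vector_fields A"
    and "\<And>Z p. Z \<in> vector_fields A \<Longrightarrow> G X Z p = G Y Z p"
  shows "X = Y"
proof -
  \<comment> \<open>The difference is tested against itself; its second occurrence stays unexpanded
    in order to match the assumption.\<close>
  have "X - Y = 0"
    using assms(1,2) assms(3)[of "X - Y"] by (intro vf_eq_zeroI) (simp_all del: G_diff(2))
  then show ?thesis
    by simp
qed

section \<open>Rules for the connection\<close>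

lemma D_vf [simp]: "X \<in> vector_fields A \<Longrightarrow> Y \<in> vector_fields A \<Longrightarrow> D X Y \<in> vector_fields A"
  using levi_civita by (simp add: levi_civita_connection_def affine_connection_def)

lemma D_add_right:
  "X \<in> vector_fields A \<Longrightarrow> Y \<in> vector_fields A \<Longrightarrow> Z \<in> vector_fields A \<Longrightarrow>
    D X (Y + Z) = D X Y + D X Z"
  using levi_civita unfolding levi_civita_connection_def affine_connection_def by blast

lemma D_fun_scale_right:
  "f \<in> smooth_functions A \<Longrightarrow> X \<in> vector_fields A \<Longrightarrow> Y \<in> vector_fields A \<Longrightarrow>
    D X (f *\<^sub>F Y) = lie_deriv X f *\<^sub>F Y + f *\<^sub>F D X Y"
  using levi_civita unfolding levi_civita_connection_def affine_connection_def by blast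

lemma torsion_free:
  "X \<in> vector_fields A \<Longrightarrow> Y \<in> vector_fields A \<Longrightarrow> bracket X Y = D X Y - D Y X"
  using levi_civita by (simp add: levi_civita_connection_def)

lemma metric_compatible:
  "X \<in> vector_fields A \<Longrightarrow> Y \<in> vector_fields A \<Longrightarrow> Z \<in> vector_fields A \<Longrightarrow>
    X p (G Y Z) = G (D X Y) Z p + G Y (D X Z) p"
  using levi_civita by (simp add: levi_civita_connection_def app2_def)

lemma D_diff_right:
  assumes "X \<in> vector_fields A" and "Y \<in> vector_fields A" and "Z \<in> vector_fields A"
  shows "D X (Y - Z) = D X Y - D X Z"
  using D_add_right[of X "Y - Z" Z] assms by simp

lemma D_zero_right: "X \<in> vector_fields A \<Longrightarrow> D X 0 = 0"
  using D_diff_right[of X 0 0] by simp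

lemma D_zero_left: "X \<in> vector_fields A \<Longrightarrow> D 0 X = 0"
  using levi_civita unfolding levi_civita_connection_def affine_connection_def
  by (metis add_cancel_right_left vf_zero)

lemma D_sum_right:
  "X \<in> vector_fields A \<Longrightarrow> \<forall>i\<in>I. F i \<in> vector_fields A \<Longrightarrow>
    D X (\<Sum>i\<in>I. F i) = (\<Sum>i\<in>I. D X (F i))"
  by (induction I rule: infinite_finite_induct) (auto simp: D_zero_right D_add_right)

section \<open>Symmetries of the curvature\<close>

lemma R_vf [simp]:
  "X \<in> vector_fields A \<Longrightarrow> Y \<in> vector_fields A \<Longrightarrow> Z \<in> vector_fields A \<Longrightarrow>
    R X Y Z \<in> vector_fields A"
  by (simp add: curvature_def)

lemma R_zero_right: "X \<in> vector_fields A \<Longrightarrow> Y \<in> vector_fields A \<Longrightarrow> R X Y 0 = 0"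
  by (simp add: curvature_def D_zero_right)

lemma D_uminus_left:
  assumes "X \<in> vector_fields A" and "Y \<in> vector_fields A"
  shows "D (- X) Y = - D X Y"
  using levi_civita assms by (simp add: levi_civita_connection_def affine_connection_def uminus_vf)

lemma R_swap:
  assumes "X \<in> vector_fields A" and "Y \<in> vector_fields A" and "Z \<in> vector_fields A"
  shows "R Y X Z = - R X Y Z"
  using assms by (simp add: curvature_def bracket_swap[of Y X] D_uminus_left)

text \<open>Both sides come from applying \<open>[X, Y] = X Y - Y X\<close> to the function
  \<open>G Z W\<close>: the mixed terms with one derivative on each argument are symmetric in
  \<open>X\<close> and \<open>Y\<close> and drop out.\<close>

lemma R_skew:
  assumes "X \<in> vector_fields A" and "Y \<in> vector_fields A"
    and "Z \<in> vector_fields A" and "W \<in> vector_fields A"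
  shows "G (R X Y Z) W p = - G (R X Y W) Z p"
proof -
  have second: "V p (\<lambda>q. U q (G Z W)) = G (D V (D U Z)) W p + G (D U Z) (D V W) p
      + G (D V Z) (D U W) p + G Z (D V (D U W)) p"
    if "U \<in> vector_fields A" and "V \<in> vector_fields A" for U V
    using that assms
    by (simp add: metric_compatible tangent_apply_add[of _ p])
  have "bracket X Y p (G Z W) = X p (\<lambda>q. Y q (G Z W)) - Y p (\<lambda>q. X q (G Z W))"
    by (simp add: bracket_apply)
  moreover have "bracket X Y p (G Z W) = G (D (bracket X Y) Z) W p + G Z (D (bracket X Y) W) p"
    using assms by (simp add: metric_compatible)
  ultimately show ?thesis
    using assms G_sym[of Z "R X Y W" p] second[of X Y] second[of Y X]
    by (simp add: curvature_def)
qed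

text \<open>The cyclic sum regroups into three expressions of the shape shown first in the proof.
  Absence of torsion, used twice, turns each into an iterated bracket, and \<open>jacobi\<close>
  sums these to zero.\<close>

lemma bianchi:
  assumes X: "X \<in> vector_fields A" and Y: "Y \<in> vector_fields A" and Z: "Z \<in> vector_fields A"
  shows "R X Y Z + R Y Z X + R Z X Y = 0"
proof -
  have "D U (D V W) - D U (D W V) - D (bracket V W) U = bracket U (bracket V W)"
    if "U \<in> vector_fields A" and "V \<in> vector_fields A" and "W \<in> vector_fields A" for U V W
    using that by (simp add: torsion_free[of U "bracket V W"]) (simp add: torsion_free D_diff_right)
  from this[OF X Y Z] this[OF Y Z X] this[OF Z X Y] jacobi[OF X Y Z] show ?thesis
    by (simp add: curvature_def algebra_simps)
qed

lemma R_pair_symmetry: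
  assumes "X \<in> vector_fields A" and "Y \<in> vector_fields A"
    and "Z \<in> vector_fields A" and "W \<in> vector_fields A"
  shows "G (R X Y Z) W p = G (R Z W X) Y p"
proof -
  have cyclic: "G (R U V T) S p + G (R V T U) S p + G (R T U V) S p = 0"
    if "U \<in> vector_fields A" and "V \<in> vector_fields A"
      and "T \<in> vector_fields A" and "S \<in> vector_fields A" for U V T S
    using arg_cong[OF bianchi[OF that(1-3)], of "\<lambda>B. G B S p"] that by simp
  have swap: "G (R U V T) S p = - G (R V U T) S p"
    if "U \<in> vector_fields A" and "V \<in> vector_fields A"
      and "T \<in> vector_fields A" and "S \<in> vector_fields A" for U V T S
    using that by (simp add: R_swap[of U V])
  show ?thesis
    \<comment> \<open>The first two Bianchi identities minus the last two reduce, by skewness in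
      either pair, to twice the claim.\<close>
    using cyclic[OF assms(1,2,3,4)] cyclic[OF assms(2,3,4,1)] cyclic[OF assms(3,4,1,2)]
      cyclic[OF assms(4,1,2,3)]
      swap[OF assms(3,1,2,4)] R_skew[OF assms(2,3,4,1), of p] R_skew[OF assms(3,4,2,1), of p]
      swap[OF assms(4,2,3,1)] R_skew[OF assms(2,4,3,1), of p] swap[OF assms(4,1,3,2)]
      R_skew[OF assms(1,4,3,2), of p] R_skew[OF assms(1,3,4,2), of p] swap[OF assms(4,1,2,3)]
      R_skew[OF assms(1,2,4,3), of p]
    by linarith
qed

end

section \<open>Generalized Kenmotsu manifolds\<close>

locale generalized_Kenmotsu = riemannian_manifold A g D
  for A :: "('a::{t2_space,second_countable_topology}, 'e::euclidean_space) atlas"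
    and g :: "'a form2" and D :: "'a connection" +
  fixes n s :: nat
    and \<phi> :: "'a endo" and \<xi> :: "nat \<Rightarrow> 'a vfield" and \<eta> :: "nat \<Rightarrow> 'a form1"
  assumes s_pos: "s \<ge> 1"
    and Kenmotsu: "generalized_Kenmotsu_manifold A n s \<phi> \<xi> \<eta> g"
begin

abbreviation J :: "'a vfield \<Rightarrow> 'a vfield" where
  "J \<equiv> app1 \<phi>"

section \<open>The structure axioms as identities between vector fields\<close>

lemma metric_f: "metric_f_manifold A n s \<phi> \<xi> \<eta> g"
  using Kenmotsu by (simp add: generalized_Kenmotsu_manifold_def
      generalized_almost_Kenmotsu_manifold_def almost_s_contact_metric_manifold_def)

lemma endo: "endomorphism_field A \<phi>"
  using metric_f by (simp add: metric_f_manifold_def)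

lemma J_vf [simp]: "X \<in> vector_fields A \<Longrightarrow> J X \<in> vector_fields A"
  using endo by (simp add: endomorphism_field_def)

lemma J_add: "X \<in> vector_fields A \<Longrightarrow> Y \<in> vector_fields A \<Longrightarrow> J (X + Y) = J X + J Y"
  using endo by (auto simp: endomorphism_field_def app1_def)

lemma J_fun_scale: "X \<in> vector_fields A \<Longrightarrow> J (f *\<^sub>F X) = f *\<^sub>F J X"
  using endo by (auto simp: endomorphism_field_def app1_def fun_scale_def)

lemma J_diff:
  assumes "X \<in> vector_fields A" and "Y \<in> vector_fields A"
  shows "J (X - Y) = J X - J Y"
  using J_add[of "X - Y" Y] assms by simp

lemma J_zero: "J 0 = 0"
  using J_diff[of 0 0] by simp

lemma \<xi>_vf [simp]: "i < s \<Longrightarrow> \<xi> i \<in> vector_fields A"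
  using metric_f by (simp add: metric_f_manifold_def)

lemma \<eta>_\<xi>: "i < s \<Longrightarrow> j < s \<Longrightarrow> \<eta> i p (\<xi> j p) = (if i = j then 1 else 0)"
  using metric_f by (simp add: metric_f_manifold_def)

lemma \<eta>_scale: "i < s \<Longrightarrow> v \<in> tangent_space A p \<Longrightarrow> \<eta> i p (c *\<^sub>T v) = c * \<eta> i p v"
  using metric_f by (simp add: metric_f_manifold_def one_form_def)

lemma J_J_\<eta>:
  "X \<in> vector_fields A \<Longrightarrow> J (J X) = - X + (\<Sum>i<s. app1 (\<eta> i) X *\<^sub>F \<xi> i)"
  using metric_f by (auto simp: metric_f_manifold_def app1_def fun_scale_def sum_fun_apply)

lemma G_J_J_\<eta>:
  "X \<in> vector_fields A \<Longrightarrow> Y \<in> vector_fields A \<Longrightarrow>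
    G (J X) (J Y) p = G X Y p - (\<Sum>i<s. \<eta> i p (X p) * \<eta> i p (Y p))"
  using metric_f by (simp add: metric_f_manifold_def app1_def app2_def)

lemma closed:
  "i < s \<Longrightarrow> X \<in> vector_fields A \<Longrightarrow> Y \<in> vector_fields A \<Longrightarrow>
    X p (app1 (\<eta> i) Y) - Y p (app1 (\<eta> i) X) = \<eta> i p (bracket X Y p)"
  using Kenmotsu
  by (simp add: generalized_Kenmotsu_manifold_def generalized_almost_Kenmotsu_manifold_def d1_def)

lemma nijenhuis_zero:
  assumes "X \<in> vector_fields A" and "Y \<in> vector_fields A"
  shows "nijenhuis \<phi> X Y = 0"
proof -
  have "nijenhuis \<phi> X Y + (\<Sum>i<s. (\<lambda>p. 2 * d1 (\<eta> i) X Y p) *\<^sub>F \<xi> i) = 0"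
    using Kenmotsu assms by (simp add: generalized_Kenmotsu_manifold_def normal_structure_def)
  moreover have "(\<Sum>i<s. (\<lambda>p. 2 * d1 (\<eta> i) X Y p) *\<^sub>F \<xi> i) = 0"
    using assms closed
    by (intro sum.neutral) (auto simp: d1_def fun_scale_def scale_def fun_eq_iff)
  ultimately show ?thesis
    by simp
qed

text \<open>The factor 1/3 of \<open>d2\<close> matches 2 times the 1/6 of \<open>wedge_1_2\<close>,
  so no constant is left. Both orders of the arguments of \<open>\<Phi>\<close> are kept, since this
  equation is what yields skewness.\<close>

lemma d_fundamental:
  assumes "X \<in> vector_fields A" and "Y \<in> vector_fields A" and "Z \<in> vector_fields A"
  shows "X p (G Y (J Z)) + Y p (G Z (J X)) + Z p (G X (J Y))
      - G (bracket X Y) (J Z) p - G (bracket Y Z) (J X) p - G (bracket Z X) (J Y) p =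
    (\<Sum>i<s. \<eta> i p (X p) * (G Y (J Z) p - G Z (J Y) p)
      + \<eta> i p (Y p) * (G Z (J X) p - G X (J Z) p)
      + \<eta> i p (Z p) * (G X (J Y) p - G Y (J X) p))" (is "?L = ?S")
proof -
  have [simp]: "app2 (fundamental_form \<phi> g) U V = G U (J V)" for U V
    by (simp add: fundamental_form_def app1_def app2_def)
  have [simp]: "fundamental_form \<phi> g p (U p) (V p) = G U (J V) p" for U V
    by (simp add: fundamental_form_def app1_def app2_def)
  have "d2 (fundamental_form \<phi> g) X Y Z p =
        2 * (\<Sum>i<s. wedge 1 2 (alt1 (\<eta> i p)) (alt2 (fundamental_form \<phi> g p))
                     (\<lambda>j. [X p, Y p, Z p] ! j))"
    using Kenmotsu assms
    by (simp add: generalized_Kenmotsu_manifold_def generalized_almost_Kenmotsu_manifold_def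
        del: sum_divide_distrib)
  also have "(\<Sum>i<s. wedge 1 2 (alt1 (\<eta> i p)) (alt2 (fundamental_form \<phi> g p))
                     (\<lambda>j. [X p, Y p, Z p] ! j)) = ?S / 6"
    unfolding wedge_1_2 sum_divide_distrib by (intro sum.cong refl) (simp add: numeral_2_eq_2)
  finally show ?thesis
    by (simp add: d2_def)
qed

text \<open>
  For \<open>s \<ge> 2\<close> the algebraic axioms do not make \<open>\<Phi>\<close> skew: they allow \<open>\<phi> \<xi>\<^sub>0 = \<xi>\<^sub>1\<close>, \<open>\<phi> \<xi>\<^sub>1 = 0\<close>
  with \<open>\<bar>\<xi>\<^sub>0\<bar>\<^sup>2 = 2\<close>. Skewness is forced by the equation for \<open>d\<Phi>(X, Y, Z)\<close>: its right hand side is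
  linear over functions in \<open>X\<close>, and replacing \<open>X\<close> by \<open>f X\<close> on the left produces the additional term
  \<open>Y(f) (\<Phi>(X, Z) + \<Phi>(Z, X))\<close>. Take \<open>Y = \<xi>\<^sub>0\<close>, which vanishes nowhere.
\<close>
lemma \<Phi>_skew:
  assumes X: "X \<in> vector_fields A" and Z: "Z \<in> vector_fields A"
  shows "G X (J Z) p = - G (J X) Z p"
proof -
  let ?Y = "\<xi> 0"
  have Y: "?Y \<in> vector_fields A"
    using s_pos by simp
  obtain f where nz: "?Y p f \<noteq> 0"
  proof -
    have "\<eta> 0 p (0 *\<^sub>T ?Y p) = 0"
      using s_pos Y by (subst \<eta>_scale) auto
    moreover have "\<eta> 0 p (?Y p) = 1"
      using s_pos by (simp add: \<eta>_\<xi>)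
    ultimately have "?Y p \<noteq> 0 *\<^sub>T ?Y p"
      by auto
    then show ?thesis
      using that by (auto simp: scale_def fun_eq_iff)
  qed
  \<comment> \<open>Smoothness is automatic, because a tangent vector is \<open>0\<close> on
    non-smooth functions.\<close>
  then have f: "f \<in> smooth_functions A"
    using tangent_apply_not_smooth[OF vf_tangent[OF Y]] by blast
  have lin: "G (f *\<^sub>F X) V = (\<lambda>q. f q * G X V q)" "G V (f *\<^sub>F X) = (\<lambda>q. f q * G V X q)"
    if "V \<in> vector_fields A" "X \<in> vector_fields A" for V X
    using that f by (simp_all add: fun_eq_iff)
  have br: "G (bracket (f *\<^sub>F X) U) V p = f p * G (bracket X U) V p - U p f * G X V p"
    "G (bracket U (f *\<^sub>F X)) V p = f p * G (bracket U X) V p + U p f * G X V p"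
    if "U \<in> vector_fields A" "V \<in> vector_fields A" for U V
  proof -
    \<comment> \<open>The bracket formulas are identities of tangent vectors at \<open>p\<close>.
      Freezing their coefficients to the constants \<open>a\<close> and \<open>b\<close> gives
      vector fields to which linearity of \<open>G\<close> applies.\<close>
    have *: "G B V p = a * G B' V p + b * G X V p"
      if "B p = a *\<^sub>T B' p + b *\<^sub>T X p" "B' \<in> vector_fields A" for B B' a b
    proof -
      have "G B V p = G ((\<lambda>_. a) *\<^sub>F B' + (\<lambda>_. b) *\<^sub>F X) V p"
        using that(1) by (simp add: app2_def fun_scale_def)
      then show ?thesis
        using that(2) X \<open>V \<in> vector_fields A\<close> by simp
    qed
    show "G (bracket (f *\<^sub>F X) U) V p = f p * G (bracket X U) V p - U p f * G X V p"
      using *[of "bracket (f *\<^sub>F X) U" "f p" "bracket X U" "- U p f"]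
        bracket_fun_scale_left[OF f X that(1)] X that by simp
    show "G (bracket U (f *\<^sub>F X)) V p = f p * G (bracket U X) V p + U p f * G X V p"
      using *[of "bracket U (f *\<^sub>F X)" "f p" "bracket U X" "U p f"]
        bracket_fun_scale_right[OF f X that(1)] X that by simp
  qed
  have ft: "(f *\<^sub>F X) p h = f p * X p h" for h
    by (simp add: fun_scale_def scale_def)
  have \<eta>f: "\<eta> i p ((f *\<^sub>F X) p) = f p * \<eta> i p (X p)" if "i < s" for i
    using that X by (simp add: fun_scale_def \<eta>_scale)
  let ?S = "\<lambda>X. \<Sum>i<s. \<eta> i p (X p) * (G ?Y (J Z) p - G Z (J ?Y) p)
      + \<eta> i p (?Y p) * (G Z (J X) p - G X (J Z) p)
      + \<eta> i p (Z p) * (G X (J ?Y) p - G ?Y (J X) p)"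
  let ?L = "\<lambda>X. X p (G ?Y (J Z)) + ?Y p (G Z (J X)) + Z p (G X (J ?Y))
      - G (bracket X ?Y) (J Z) p - G (bracket ?Y Z) (J X) p - G (bracket Z X) (J ?Y) p"
  have "?S (f *\<^sub>F X) = f p * ?S X"
    using X Y Z f unfolding sum_distrib_left
    by (intro sum.cong refl) (simp add: \<eta>f J_fun_scale algebra_simps)
  moreover have "?L (f *\<^sub>F X) = f p * ?L X + ?Y p f * (G Z (J X) p + G X (J Z) p)"
    using X Y Z f by (simp add: ft lin br J_fun_scale tangent_apply_mult[of _ p] algebra_simps)
  moreover have "?L (f *\<^sub>F X) = ?S (f *\<^sub>F X)" and "?L X = ?S X"
    using d_fundamental[OF _ Y Z] X f by (blast intro: vf_fun_scale)+
  ultimately have "?Y p f * (G Z (J X) p + G X (J Z) p) = 0"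
    by simp
  then show ?thesis
    using nz X Z G_sym[of Z "J X" p] by simp
qed

text \<open>The axioms give only \<open>J (J (\<xi> i)) = 0\<close>; skewness of
  \<open>\<Phi>\<close> then makes the squared length of \<open>J (\<xi> i)\<close> equal to
  \<open>- g(\<xi>_i, J (J \<xi>_i)) = 0\<close>.\<close>

lemma J_\<xi> [simp]:
  assumes "i < s"
  shows "J (\<xi> i) = 0"
proof (rule vf_eq_zeroI)
  have "(\<Sum>j<s. app1 (\<eta> j) (\<xi> i) *\<^sub>F \<xi> j) = (\<Sum>j<s. if j = i then \<xi> i else 0)"
    using assms by (intro sum.cong refl) (auto simp: app1_def \<eta>_\<xi> fun_scale_def scale_def fun_eq_iff)
  then have "J (J (\<xi> i)) = 0"
    using assms by (simp add: J_J_\<eta>)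
  then show "G (J (\<xi> i)) (J (\<xi> i)) p = 0" for p
    using assms \<Phi>_skew[of "\<xi> i" "J (\<xi> i)" p] by simp
qed (use assms in simp)

text \<open>Put \<open>\<xi> i\<close> into the compatibility of \<open>g\<close> with
  \<open>\<phi>\<close>: the left side vanishes with \<open>J (\<xi> i)\<close>, and duality leaves
  one term of the sum.\<close>

lemma \<eta>_eq:
  assumes "i < s" and "X \<in> vector_fields A"
  shows "\<eta> i p (X p) = G X (\<xi> i) p"
proof -
  have "(\<Sum>j<s. \<eta> j p (X p) * \<eta> j p (\<xi> i p)) = (\<Sum>j<s. if j = i then \<eta> i p (X p) else 0)"
    using assms by (intro sum.cong refl) (auto simp: \<eta>_\<xi>)
  then show ?thesis
    using G_J_J_\<eta>[of X "\<xi> i" p] assms by simp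
qed

lemma app1_\<eta>: "i < s \<Longrightarrow> X \<in> vector_fields A \<Longrightarrow> app1 (\<eta> i) X = G X (\<xi> i)"
  by (simp add: fun_eq_iff \<eta>_eq app1_def)

lemma G_\<xi>_\<xi> [simp]: "i < s \<Longrightarrow> j < s \<Longrightarrow> G (\<xi> i) (\<xi> j) = (\<lambda>_. if i = j then 1 else 0)"
  using \<eta>_\<xi>[of j i] by (auto simp: fun_eq_iff \<eta>_eq)

lemma G_J_\<xi> [simp]: "i < s \<Longrightarrow> X \<in> vector_fields A \<Longrightarrow> G (J X) (\<xi> i) = (\<lambda>_. 0)"
  using \<Phi>_skew[of X "\<xi> i"] by (auto simp: fun_eq_iff)

section \<open>The splitting into horizontal and vertical parts\<close>

definition horizontal_part :: "'a vfield \<Rightarrow> 'a vfield" where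
  "horizontal_part X = X - (\<Sum>i<s. G X (\<xi> i) *\<^sub>F \<xi> i)"

definition \<eta>_sum :: "'a vfield \<Rightarrow> 'a \<Rightarrow> real" where
  "\<eta>_sum X = (\<lambda>p. \<Sum>i<s. G X (\<xi> i) p)"

lemma J_J: "X \<in> vector_fields A \<Longrightarrow> J (J X) = - horizontal_part X"
  by (simp add: J_J_\<eta> horizontal_part_def app1_\<eta> cong: sum.cong_simp)

lemma horizontal_part_vf [simp]: "X \<in> vector_fields A \<Longrightarrow> horizontal_part X \<in> vector_fields A"
  by (simp add: horizontal_part_def)

lemma horizontal_part_J: "X \<in> vector_fields A \<Longrightarrow> horizontal_part (J X) = J X"
  using J_J[of "J X"] J_J[of X]
  by (simp add: horizontal_part_def cong: sum.cong_simp)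
    (simp add: fun_scale_def scale_def fun_eq_iff sum_fun_apply)

text \<open>\<open>J X = 0\<close> kills the horizontal part, which is \<open>- J (J X)\<close>; the
  remaining components along the \<open>\<xi> i\<close> vanish by the last assumption. Identities
  between brackets are checked in this way.\<close>

lemma eq_zeroI:
  assumes "X \<in> vector_fields A" and "J X = 0" and "\<And>i. i < s \<Longrightarrow> G X (\<xi> i) = (\<lambda>_. 0)"
  shows "X = 0"
  using J_J[OF assms(1)] assms
  by (simp add: J_zero horizontal_part_def cong: sum.cong_simp)
    (simp add: fun_scale_def scale_def fun_eq_iff sum_fun_apply)

section \<open>Lie derivatives along the structure fields\<close>

lemma closed_G:
  "i < s \<Longrightarrow> X \<in> vector_fields A \<Longrightarrow> Y \<in> vector_fields A \<Longrightarrow>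
    G (bracket X Y) (\<xi> i) p = X p (G Y (\<xi> i)) - Y p (G X (\<xi> i))"
  using closed[of i X Y p] by (simp add: app1_\<eta> \<eta>_eq)

lemma bracket_zero: "X \<in> vector_fields A \<Longrightarrow> bracket 0 X = 0" "X \<in> vector_fields A \<Longrightarrow> bracket X 0 = 0"
  by (simp_all add: torsion_free D_zero_left D_zero_right)

lemma G_bracket_\<xi>:
  assumes "i < s" and "j < s" and "X \<in> vector_fields A"
  shows "G (bracket (\<xi> i) X) (\<xi> j) p = \<xi> i p (G X (\<xi> j))"
  using assms by (simp add: closed_G vf_const[of X])

text \<open>This is \<open>L_\<xi> \<phi> = 0\<close>. As \<open>J (\<xi> i) = 0\<close>, the
  Nijenhuis tensor at \<open>(\<xi> i, X)\<close> is \<open>- J ?C\<close>, so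
  \<open>J ?C = 0\<close> by normality; closedness of the \<open>\<eta> j\<close> and
  \<open>J X \<bottom> \<xi> j\<close> remove the vertical components of \<open>?C\<close>.\<close>

lemma bracket_\<xi>_J:
  assumes i: "i < s" and X: "X \<in> vector_fields A"
  shows "bracket (\<xi> i) (J X) = J (bracket (\<xi> i) X)"
proof -
  let ?C = "bracket (\<xi> i) (J X) - J (bracket (\<xi> i) X)"
  have "nijenhuis \<phi> (\<xi> i) X = - J ?C"
    using assms by (simp add: nijenhuis_def bracket_zero J_zero J_diff)
  then have J: "J ?C = 0"
    using nijenhuis_zero[OF \<xi>_vf[OF i] X] by simp
  have G: "G ?C (\<xi> j) = (\<lambda>_. 0)" if "j < s" for j
    using that i X by (simp add: fun_eq_iff G_bracket_\<xi> vf_const[OF \<xi>_vf])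
  have "?C = 0"
    using i X by (intro eq_zeroI[OF _ J G]) simp_all
  then show ?thesis
    by simp
qed

text \<open>By \<open>bracket_\<xi>_J\<close>, \<open>J\<close> maps the bracket to
  \<open>bracket (\<xi> i) 0\<close>, and by closedness its vertical components are derivatives of
  the constants \<open>G (\<xi> j) (\<xi> k)\<close>.\<close>

lemma bracket_\<xi>_\<xi>:
  assumes i: "i < s" and j: "j < s"
  shows "bracket (\<xi> i) (\<xi> j) = 0"
proof (rule eq_zeroI)
  show "J (bracket (\<xi> i) (\<xi> j)) = 0"
    using bracket_\<xi>_J[OF i, of "\<xi> j"] i j by (simp add: bracket_zero)
  show "G (bracket (\<xi> i) (\<xi> j)) (\<xi> k) = (\<lambda>_. 0)" if "k < s" for k
    using that i j by (simp add: fun_eq_iff G_bracket_\<xi> vf_const[OF \<xi>_vf])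
qed (use i j in simp)

section \<open>The covariant derivatives of the structure fields\<close>

lemma D_\<xi>_symmetric:
  assumes "i < s" and "X \<in> vector_fields A" and "Y \<in> vector_fields A"
  shows "G (D X (\<xi> i)) Y p = G (D Y (\<xi> i)) X p"
  \<comment> \<open>Metric compatibility and absence of torsion identify the skew part of
    \<open>X \<mapsto> D X (\<xi> i)\<close> with \<open>d\<eta>\<close>, up to a factor.\<close>
  using closed_G[of i X Y p] assms G_sym[of X "D Y (\<xi> i)" p] G_sym[of Y "D X (\<xi> i)" p]
  by (simp add: metric_compatible torsion_free)

text \<open>The left hand side is twice the symmetrized covariant derivative of \<open>\<xi>\<^sub>i\<close>.\<close>
lemma lie_derivative_metric:
  assumes "i < s" and "X \<in> vector_fields A" and "Y \<in> vector_fields A"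
  shows "2 * G (D X (\<xi> i)) Y p =
    \<xi> i p (G X Y) - G (bracket (\<xi> i) X) Y p - G X (bracket (\<xi> i) Y) p"
  using assms D_\<xi>_symmetric[OF assms, of p] G_sym[of X "D Y (\<xi> i)" p]
  by (simp add: metric_compatible torsion_free)

text \<open>With \<open>\<xi> i\<close> as first argument, the equation for \<open>d\<Phi>\<close>
  says \<open>L_\<xi> \<Phi> = 2 \<Phi>\<close>: on the right only \<open>j = i\<close> survives,
  and skewness doubles its term. Because \<open>L_\<xi>\<close> commutes with \<open>J\<close>, the
  left side is the Lie derivative of the metric at \<open>(X, J Y)\<close>.\<close>

lemma G_D_\<xi>_J:
  assumes i: "i < s" and X: "X \<in> vector_fields A" and Y: "Y \<in> vector_fields A"
  shows "G (D X (\<xi> i)) (J Y) p = G X (J Y) p"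
proof -
  have sum: "(\<Sum>j<s. \<eta> j p (\<xi> i p) * (G X (J Y) p - G Y (J X) p)
      + \<eta> j p (X p) * (G Y (J (\<xi> i)) p - G (\<xi> i) (J Y) p)
      + \<eta> j p (Y p) * (G (\<xi> i) (J X) p - G X (J (\<xi> i)) p)) =
    (\<Sum>j<s. if j = i then G X (J Y) p - G Y (J X) p else 0)"
    using assms by (intro sum.cong refl) (auto simp: \<eta>_\<xi> \<Phi>_skew)
  have zero: "G (\<xi> i) (J X) = (\<lambda>_. 0)" "G Y 0 = (\<lambda>_. 0)"
    using assms by (auto simp: fun_eq_iff \<Phi>_skew)
  have skew: "G (bracket Y (\<xi> i)) (J X) p = G X (J (bracket (\<xi> i) Y)) p" "G Y (J X) p = - G X (J Y) p"
    using assms \<Phi>_skew[of X "bracket (\<xi> i) Y" p] \<Phi>_skew[of X Y p]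
      G_sym[of "J X" "bracket (\<xi> i) Y" p] G_sym[of Y "J X" p]
    by (simp_all add: bracket_swap[of Y "\<xi> i"])
  show ?thesis
    using d_fundamental[of "\<xi> i" X Y p, unfolded sum] lie_derivative_metric[OF i X, of "J Y" p] assms
    by (simp add: zero skew bracket_\<xi>_J vf_const[OF X] vf_const[OF Y])
qed

text \<open>\<open>G_D_\<xi>_J\<close> settles the horizontal components, since each horizontal part
  is \<open>J\<close> of some field; the vertical ones vanish by
  \<open>lie_derivative_metric\<close> against \<open>\<xi> j\<close>.\<close>

lemma D_\<xi>:
  assumes i: "i < s" and X: "X \<in> vector_fields A"
  shows "D X (\<xi> i) = horizontal_part X"
proof (rule vf_eqI)
  fix W p assume W: "W \<in> vector_fields A"
  have \<xi>0: "G (D X (\<xi> i)) (\<xi> j) p = 0" if "j < s" for j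
    using lie_derivative_metric[OF i X, of "\<xi> j" p] that i X
    by (simp add: G_bracket_\<xi> bracket_\<xi>_\<xi>)
  have "G (D X (\<xi> i)) (horizontal_part W) p = G X (horizontal_part W) p"
    using G_D_\<xi>_J[OF i X, of "J W" p] assms W by (simp add: J_J)
  then show "G (D X (\<xi> i)) W p = G (horizontal_part X) W p"
    using assms W \<xi>0 by (simp add: horizontal_part_def mult.commute G_sym[of "\<xi> _" W])
qed (use assms in simp_all)

section \<open>Curvature with a structure field among its arguments\<close>

lemma R_\<xi>:
  assumes i: "i < s" and X: "X \<in> vector_fields A" and Y: "Y \<in> vector_fields A"
  shows "R X Y (\<xi> i) = \<eta>_sum X *\<^sub>F horizontal_part Y - \<eta>_sum Y *\<^sub>F horizontal_part X"
proof (intro ext)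
  fix p f
  \<comment> \<open>The inner derivative is \<open>V\<close> minus its vertical components; the
    Leibniz rule applies to these, and \<open>D U (\<xi> j)\<close> is again the horizontal part of
    \<open>U\<close>.\<close>
  have DD: "D U (D V (\<xi> i)) p f = D U V p f
      - (\<Sum>j<s. U p (G V (\<xi> j)) * \<xi> j p f + G V (\<xi> j) p * horizontal_part U p f)"
    if U: "U \<in> vector_fields A" and V: "V \<in> vector_fields A" for U V
  proof -
    have "D U (D V (\<xi> i)) = D U V - (\<Sum>j<s. D U (G V (\<xi> j) *\<^sub>F \<xi> j))"
      using U V i by (simp add: D_\<xi>) (simp add: horizontal_part_def D_diff_right D_sum_right)
    also have "(\<Sum>j<s. D U (G V (\<xi> j) *\<^sub>F \<xi> j)) =
        (\<Sum>j<s. lie_deriv U (G V (\<xi> j)) *\<^sub>F \<xi> j + G V (\<xi> j) *\<^sub>F horizontal_part U)"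
      using U V by (intro sum.cong refl) (simp add: D_fun_scale_right D_\<xi>)
    finally show ?thesis
      by (simp add: sum_fun_apply fun_scale_def scale_def lie_deriv_def)
  qed
  \<comment> \<open>Closedness gives the vertical components of the bracket, which cancel the
    differentiated coefficients in \<open>DD\<close>; absence of torsion cancels
    \<open>D X Y - D Y X\<close>.\<close>
  have "D (bracket X Y) (\<xi> i) p f = D X Y p f - D Y X p f
      - (\<Sum>j<s. (X p (G Y (\<xi> j)) - Y p (G X (\<xi> j))) * \<xi> j p f)"
    using assms
    by (simp add: D_\<xi> horizontal_part_def sum_fun_apply fun_scale_def scale_def closed_G
        cong: sum.cong_simp)
      (simp add: torsion_free)
  then show "R X Y (\<xi> i) p f =
      (\<eta>_sum X *\<^sub>F horizontal_part Y - \<eta>_sum Y *\<^sub>F horizontal_part X) p f"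
    using assms
    by (simp add: curvature_def DD \<eta>_sum_def fun_scale_def scale_def sum.distrib sum_subtractf
        sum_distrib_right left_diff_distrib)
qed

lemma \<eta>_sum_smooth [simp]: "X \<in> vector_fields A \<Longrightarrow> \<eta>_sum X \<in> smooth_functions A"
proof -
  assume "X \<in> vector_fields A"
  \<comment> \<open>The bound keeps the induction within the indices for which
    \<open>\<xi> i\<close> is a vector field.\<close>
  then have "k \<le> s \<Longrightarrow> (\<lambda>p. \<Sum>i<k. G X (\<xi> i) p) \<in> smooth_functions A" for k
    by (induction k) simp_all
  then show ?thesis
    by (simp add: \<eta>_sum_def)
qed

text \<open>Pair symmetry turns \<open>g(R(\<xi>_i, X) Z, W)\<close> into
  \<open>g(R(Z, W) \<xi>_i, X)\<close>, which \<open>R_\<xi>\<close> evaluates; the field is read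
  off by letting \<open>W\<close> vary.\<close>

lemma R_\<xi>_left:
  assumes i: "i < s" and X: "X \<in> vector_fields A" and Z: "Z \<in> vector_fields A"
  shows "R (\<xi> i) X Z = \<eta>_sum Z *\<^sub>F horizontal_part X - G (horizontal_part Z) X *\<^sub>F (\<Sum>j<s. \<xi> j)"
proof (rule vf_eqI)
  fix W p assume W: "W \<in> vector_fields A"
  have "G (horizontal_part W) X p = G (horizontal_part X) W p"
    using X W by (simp add: horizontal_part_def mult.commute G_sym[of "\<xi> _"] G_sym[of W X])
  moreover have "\<eta>_sum W p = (\<Sum>j<s. G (\<xi> j) W p)"
    using W by (simp add: \<eta>_sum_def G_sym[of W])
  ultimately show "G (R (\<xi> i) X Z) W p =
      G (\<eta>_sum Z *\<^sub>F horizontal_part X - G (horizontal_part Z) X *\<^sub>F (\<Sum>j<s. \<xi> j)) W p"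
    using assms W by (simp add: R_pair_symmetry[of "\<xi> i" X Z W] R_\<xi>)
qed (use assms in simp_all)

section \<open>Semi-symmetry and the sectional curvature\<close>

lemma \<eta>_sum_\<xi>: "i < s \<Longrightarrow> \<eta>_sum (\<xi> i) = (\<lambda>_. 1)"
  by (simp add: \<eta>_sum_def fun_eq_iff)

lemma horizontal_part_\<xi>: "i < s \<Longrightarrow> horizontal_part (\<xi> i) = 0"
  using J_J[of "\<xi> i"] by (simp add: J_zero)

lemma \<eta>_sum_J: "X \<in> vector_fields A \<Longrightarrow> \<eta>_sum (J X) = (\<lambda>_. 0)"
  by (simp add: \<eta>_sum_def)

text \<open>Horizontal fields are entered as values of \<open>J\<close>, so that
  \<open>\<eta>_sum\<close> kills them and the projection fixes them. The curvature operator of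
  \<open>\<xi> 0\<close> and \<open>?V\<close> sends \<open>?U\<close> and \<open>?V\<close> to
  multiples of the sum of the \<open>\<xi> j\<close>, and \<open>\<xi> 0\<close> to
  \<open>?V\<close>. Hence the last term of its derivation identity is the curvature sought, and
  \<open>R_\<xi>\<close> evaluates the others.\<close>

lemma R_semi_symmetric:
  assumes semi: "semi_symmetric A D" and X: "X \<in> vector_fields A" and Y: "Y \<in> vector_fields A"
  shows "R (J X) (J Y) (J Y) =
    (\<lambda>p. real s * G (J X) (J Y) p) *\<^sub>F J Y - (\<lambda>p. real s * G (J Y) (J Y) p) *\<^sub>F J X"
proof -
  let ?U = "J X" and ?V = "J Y" and ?\<xi> = "\<Sum>j<s. \<xi> j"
  have s: "0 < s"
    using s_pos by simp
  have scale0: "(\<lambda>_. 0) *\<^sub>F V = 0" "(\<lambda>_. 1) *\<^sub>F V = V" for V :: "'a vfield"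
    by (auto simp: fun_scale_def scale_def fun_eq_iff)
  \<comment> \<open>The constant of the theorem enters here: each of the \<open>s\<close> structure
    fields contributes \<open>1\<close> to \<open>\<eta>_sum ?\<xi>\<close>.\<close>
  have \<xi>_sum: "\<eta>_sum (f *\<^sub>F ?\<xi>) = (\<lambda>p. real s * f p)" if "f \<in> smooth_functions A" for f
    using that by (simp add: \<eta>_sum_def fun_eq_iff flip: sum_distrib_left)
  have R\<xi>: "R (\<xi> 0) ?V W = (\<lambda>p. - G W ?V p) *\<^sub>F ?\<xi>" if "W \<in> {?U, ?V}" for W
    using that s X Y
    by (auto simp: R_\<xi>_left \<eta>_sum_J horizontal_part_J scale0)
      (auto simp: fun_scale_def scale_def fun_eq_iff)
  have "R (\<xi> 0) ?V (R ?U ?V (\<xi> 0)) - R (R (\<xi> 0) ?V ?U) ?V (\<xi> 0)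
      - R ?U (R (\<xi> 0) ?V ?V) (\<xi> 0) - R ?U ?V (R (\<xi> 0) ?V (\<xi> 0)) = 0"
    using semi X Y s by (simp add: semi_symmetric_def)
  moreover have "R ?U ?V (\<xi> 0) = 0"
    using X Y s by (simp add: R_\<xi> \<eta>_sum_J scale0)
  moreover have "R (R (\<xi> 0) ?V ?U) ?V (\<xi> 0) = (\<lambda>p. - (real s * G ?U ?V p)) *\<^sub>F ?V"
    using X Y s by (simp add: R\<xi> R_\<xi> \<xi>_sum \<eta>_sum_J horizontal_part_J scale0)
  moreover have "R ?U (R (\<xi> 0) ?V ?V) (\<xi> 0) = (\<lambda>p. real s * G ?V ?V p) *\<^sub>F ?U"
    using X Y s by (simp add: R\<xi> R_\<xi> \<xi>_sum \<eta>_sum_J horizontal_part_J scale0)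
      (simp add: fun_scale_def scale_def fun_eq_iff)
  moreover have "R (\<xi> 0) ?V (\<xi> 0) = ?V"
    using X Y s by (simp add: R_\<xi>_left \<eta>_sum_\<xi> horizontal_part_\<xi> horizontal_part_J scale0)
      (auto simp: fun_scale_def scale_def fun_eq_iff)
  ultimately show ?thesis
    using X Y s
    by (simp add: R_zero_right) (simp add: fun_scale_def scale_def fun_eq_iff)
qed

text \<open>\<open>X\<close> is horizontal only at \<open>p\<close>, whereas
  \<open>R_semi_symmetric\<close> concerns fields of the form \<open>J Y\<close>. So
  \<open>X\<close> is replaced by \<open>?H\<close>, which has this form and the same value at
  \<open>p\<close>.\<close>

lemma phi_sectional_curvature_eq:
  assumes semi: "semi_symmetric A D" and X: "X \<in> vector_fields A"
    and horizontal: "\<And>i. i < s \<Longrightarrow> G X (\<xi> i) p = 0" and unit: "G X X p = 1"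
  shows "phi_sectional_curvature \<phi> g D X p = - real s"
proof -
  let ?H = "horizontal_part X"
  have J: "J (- J X) = ?H"
    using X J_J[OF X] J_diff[of 0 "J X"] by (simp add: J_zero)
  have Hp: "?H p = X p"
    using X horizontal by (simp add: horizontal_part_def fun_scale_def scale_def sum_fun_apply fun_eq_iff)
  have eq: "G Z ?H p = G Z X p" "G ?H Z p = G X Z p" for Z
    by (simp_all add: app2_def Hp)
  have GXJ: "G X (J X) p = 0"
    using \<Phi>_skew[OF X X, of p] G_sym[OF X J_vf[OF X], of p] by simp
  have GJJ: "G (J X) (J X) p = 1"
    using G_J_J_\<eta>[OF X X, of p] X horizontal unit by (simp add: \<eta>_eq)
  have "phi_sectional_curvature \<phi> g D X p = G (R X (J X) (J X)) X p"
    by (simp add: phi_sectional_curvature_def app2_def)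
  also have "\<dots> = G (R X (J X) (J X)) ?H p"
    by (simp add: eq)
  \<comment> \<open>Pair symmetry and skewness exchange the first curvature argument with the field
    paired by \<open>g\<close>. In the latter slot only the value at \<open>p\<close> counts, so
    \<open>X\<close> may become \<open>?H\<close> there, once before and once after the
    exchange.\<close>
  also have "\<dots> = - G (R (J X) ?H (J X)) X p"
    using X R_pair_symmetry[of X "J X" "J X" ?H p] R_skew[of "J X" ?H X "J X" p] by simp
  also have "\<dots> = - G (R (J X) ?H (J X)) ?H p"
    by (simp add: eq)
  also have "\<dots> = G (R ?H (J X) (J X)) ?H p"
    using X by (simp add: R_swap[of ?H "J X"])
  also have "R ?H (J X) (J X) = (\<lambda>p. real s * G ?H (J X) p) *\<^sub>F J X
      - (\<lambda>p. real s * G (J X) (J X) p) *\<^sub>F ?H"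
    using R_semi_symmetric[OF semi, of "- J X" X] X by (simp add: J)
  also have "G \<dots> ?H p = - real s"
    using X by (simp add: eq GXJ GJJ unit)
  finally show ?thesis .
qed

end

theorem theorem5p1:
  fixes A :: "('a::{t2_space,second_countable_topology}, 'e::euclidean_space) atlas"
    and n s :: nat
    and \<phi> :: "'a endo" and \<xi> :: "nat \<Rightarrow> 'a vfield" and \<eta> :: "nat \<Rightarrow> 'a form1" and g :: "'a form2"
    and D :: "'a connection"
  assumes "n \<ge> 1" and "s \<ge> 1"
    and "generalized_Kenmotsu_manifold A n s \<phi> \<xi> \<eta> g"
    and "levi_civita_connection A g D"
    and "semi_symmetric A D"
  shows "\<forall>p. \<forall>v\<in>horizontal_space A s \<xi> g p. g p v v = 1 \<longrightarrow>
           (\<forall>X\<in>vector_fields A. X p = v \<longrightarrow> phi_sectional_curvature \<phi> g D X p = - real s)"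
proof (intro allI ballI impI)
  fix p v X
  assume v: "v \<in> horizontal_space A s \<xi> g p" "g p v v = 1"
    and X: "X \<in> vector_fields A" "X p = v"
  have "metric_f_manifold A n s \<phi> \<xi> \<eta> g"
    using assms(3) by (simp add: generalized_Kenmotsu_manifold_def
        generalized_almost_Kenmotsu_manifold_def almost_s_contact_metric_manifold_def)
  then interpret generalized_Kenmotsu A g D n s \<phi> \<xi> \<eta>
    using assms by unfold_locales (simp_all add: metric_f_manifold_def)
  show "phi_sectional_curvature \<phi> g D X p = - real s"
    using v X(2)
    by (intro phi_sectional_curvature_eq assms(5) X(1)) (auto simp: app2_def horizontal_space_def)
qed

end
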